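(* Let $a\le r$ be positive integers. Then there are infinitely many $n\ge r^{\Omega(r)}$ (each a multiple of $r$) such that, for any desired $\epsilon\in(0,0.5)$ and any positive integer $h$ with $hr\ge\Omega\!\left(\frac{n^{2/3}}{\epsilon}\right)$ (and $\frac nr a+h<n$), there is an MR $(n,r,h,a)$-LRC over a field of size at most $n^{\frac{2h}{3}(1+\epsilon)}$.
   Context: Definition: let $\ell$ be a prime power, $a,g,r,h$ positive integers with $ga+h<gr$, $n=gr$, $k=n-ga-h$. An MR (maximally recoverable) $(n,r,h,a)_\ell$-LRC is an $[n,k]$ linear code over $\mathbb{F}_\ell$ with a parity-check matrix $H$ of the block form whose first $ga$ rows are block diagonal with diagonal blocks $A_1,\dots,A_g$ (each $a\times r$, coordinates split into $g$ consecutive groups of size $r$) and whose last $h$ rows are $(D_1|\cdots|D_g)$ with each $D_i$ of size $h\times r$, such that (i) each $A_i$ generates an $[r,a,r-a+1]_\ell$ MDS code, and (ii) every set of $ag+h$ columns of $H$ consisting of any $a$ columns from each group together with any $h$ further columns is linearly independent over $\mathbb{F}_\ell$. "Over a field of size $\ell$" means an MR $(n,r,h,a)_\ell$-LRC. $\Omega(\cdot)$ is the usual asymptotic notation (lower bound up to an absolute positive constant). *)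

theory Defs
  imports "HOL-Algebra.Ring" Complex_Main
begin

text \<open>Matrices over a finite field F (HOL-Algebra record, carrier of type nat) are
  represented as functions nat => nat => nat (row index, column index), indices from 0.\<close>

definition cols_indep :: "nat ring \<Rightarrow> nat \<Rightarrow> (nat \<Rightarrow> nat \<Rightarrow> nat) \<Rightarrow> nat set \<Rightarrow> bool" where
  "cols_indep F m M S \<longleftrightarrow>
     (\<forall>c \<in> S \<rightarrow> carrier F.
        (\<forall>i<m. (\<Oplus>\<^bsub>F\<^esub>j\<in>S. c j \<otimes>\<^bsub>F\<^esub> M i j) = \<zero>\<^bsub>F\<^esub>) \<longrightarrow> (\<forall>j\<in>S. c j = \<zero>\<^bsub>F\<^esub>))"

definition gen_code :: "nat ring \<Rightarrow> nat \<Rightarrow> nat \<Rightarrow> (nat \<Rightarrow> nat \<Rightarrow> nat) \<Rightarrow> (nat \<Rightarrow> nat) set" where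
  "gen_code F a r A =
     {x. \<exists>c \<in> {0..<a} \<rightarrow> carrier F.
           x = (\<lambda>j. if j < r then (\<Oplus>\<^bsub>F\<^esub>i\<in>{0..<a}. c i \<otimes>\<^bsub>F\<^esub> A i j) else \<zero>\<^bsub>F\<^esub>)}"

definition hweight :: "nat ring \<Rightarrow> nat \<Rightarrow> (nat \<Rightarrow> nat) \<Rightarrow> nat" where
  "hweight F r x = card {j. j < r \<and> x j \<noteq> \<zero>\<^bsub>F\<^esub>}"

definition generates_code :: "nat ring \<Rightarrow> (nat \<Rightarrow> nat \<Rightarrow> nat) \<Rightarrow> nat \<Rightarrow> nat \<Rightarrow> nat \<Rightarrow> bool" where
  "generates_code F A r a d \<longleftrightarrow>
     (\<forall>i<a. \<forall>j<r. A i j \<in> carrier F) \<and>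
     (\<forall>c \<in> {0..<a} \<rightarrow> carrier F.
        (\<forall>j<r. (\<Oplus>\<^bsub>F\<^esub>i\<in>{0..<a}. c i \<otimes>\<^bsub>F\<^esub> A i j) = \<zero>\<^bsub>F\<^esub>) \<longrightarrow> (\<forall>i<a. c i = \<zero>\<^bsub>F\<^esub>)) \<and>
     (\<exists>x \<in> gen_code F a r A. (\<exists>j<r. x j \<noteq> \<zero>\<^bsub>F\<^esub>) \<and> hweight F r x = d) \<and>
     (\<forall>x \<in> gen_code F a r A. (\<exists>j<r. x j \<noteq> \<zero>\<^bsub>F\<^esub>) \<longrightarrow> d \<le> hweight F r x)"

text \<open>Parity-check matrix built from local blocks A p (p < g, each a x r) and global
  rows D (h x n): rows 0..<g*a are block diagonal, rows g*a..<g*a+h are (D_1|...|D_g).\<close>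
definition pc_matrix :: "nat ring \<Rightarrow> nat \<Rightarrow> nat \<Rightarrow> nat \<Rightarrow> (nat \<Rightarrow> nat \<Rightarrow> nat \<Rightarrow> nat)
    \<Rightarrow> (nat \<Rightarrow> nat \<Rightarrow> nat) \<Rightarrow> nat \<Rightarrow> nat \<Rightarrow> nat" where
  "pc_matrix F g r a A D i j =
     (if i < g * a then (if i div a = j div r then A (i div a) (i mod a) (j mod r) else \<zero>\<^bsub>F\<^esub>)
      else D (i - g * a) j)"

definition MR_LRC :: "nat ring \<Rightarrow> nat \<Rightarrow> nat \<Rightarrow> nat \<Rightarrow> nat \<Rightarrow> bool" where
  "MR_LRC F n r h a \<longleftrightarrow>
     (let g = n div r in
      0 < a \<and> 0 < r \<and> 0 < h \<and> 0 < g \<and> r dvd n \<and> g * a + h < g * r \<and>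
      (\<exists>A D.
         (\<forall>p<g. generates_code F (A p) r a (r - a + 1)) \<and>
         (\<forall>t<h. \<forall>j<n. D t j \<in> carrier F) \<and>
         (\<forall>T U. T \<subseteq> {0..<n} \<and> (\<forall>p<g. card {j\<in>T. j div r = p} = a) \<and>
                U \<subseteq> {0..<n} - T \<and> card U = h \<longrightarrow>
                cols_indep F (g * a + h) (pc_matrix F g r a A D) (T \<union> U))))"

end

theory Submission
  imports Defs "HOL-Algebra.Algebraic_Closure_Type" "HOL-Library.Z2"
begin

text \<open>Since \<open>n\<close> may be taken large compared with \<open>r\<close>, a counting argument suffices. Use the same
  Vandermonde matrix for every local block, over a field with \<open>2 ^ m\<close> elements where
  \<open>2 ^ m \<le> n ^ (2 h / 3) < 2 ^ (m + 1)\<close>, and choose the global columns greedily. A nonzero kernel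
  vector of a forbidden column set satisfies the local checks, so it vanishes on every group
  without one of the \<open>h\<close> extra columns; hence only column sets covered by at most \<open>h\<close> groups
  matter. Weighting each set of \<open>t\<close> groups by \<open>y ^ t\<close> with \<open>y = n ^ (- 1 / 3) / 2 ^ r\<close> bounds their
  number by \<open>y ^ (- h) * (1 + 2 ^ r * y) ^ g\<close>, which is at most \<open>(e * 2 ^ r * n ^ (1 / 3)) ^ h\<close> as soon
  as \<open>n ^ (2 / 3) \<le> h * r\<close>. For large \<open>n\<close> this is less than \<open>2 ^ m\<close>, so no step of the choice
  can fail.\<close>

section \<open>Finite subfields of a field, and existence for order \<open>2 ^ m\<close>\<close>

text \<open>A subset of a type-class field is used instead of a ring record: sums and polynomials
  live in the ambient field, and only membership of the results in \<open>K\<close> has to be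
  tracked.\<close>

locale finite_field_set =
  fixes K :: "'k::field set"
  assumes finite_K: "finite K"
    and zero_in: "0 \<in> K" and one_in: "1 \<in> K"
    and add_in: "x \<in> K \<Longrightarrow> y \<in> K \<Longrightarrow> x + y \<in> K"
    and minus_in: "x \<in> K \<Longrightarrow> - x \<in> K"
    and mult_in: "x \<in> K \<Longrightarrow> y \<in> K \<Longrightarrow> x * y \<in> K"
    and inverse_in: "x \<in> K \<Longrightarrow> inverse x \<in> K"
begin

lemma diff_in: "x \<in> K \<Longrightarrow> y \<in> K \<Longrightarrow> x - y \<in> K"
  using add_in[of x "- y"] minus_in[of y] by simp

lemma power_in: "x \<in> K \<Longrightarrow> x ^ i \<in> K"
  by (induction i) (auto simp: one_in mult_in)

lemma card_pos: "0 < card K"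
  using finite_K zero_in by (auto simp: card_gt_0_iff)

end

text \<open>Split off a root: \<open>p = (x - a) q\<close> and \<open>p' = q + (x - a) q'\<close>.
  At \<open>a\<close> this gives \<open>q(a) \<noteq> 0\<close>, so \<open>a\<close> is a new root;
  at a root of \<open>q\<close> it shows that \<open>q\<close> again has no common root with its
  derivative, so induction applies.\<close>

lemma card_roots_of_separable:
  fixes p :: "'k::alg_closed_field poly"
  assumes "p \<noteq> 0" "\<And>x. poly p x = 0 \<Longrightarrow> poly (pderiv p) x \<noteq> 0"
  shows "card {x. poly p x = 0} = Polynomial.degree p"
  using assms
proof (induction "Polynomial.degree p" arbitrary: p)
  case 0
  then obtain c where "p = [:c:]" by (metis degree_eq_zeroE)
  with 0 show ?case by simp
next
  case (Suc d)
  then obtain a where a: "poly p a = 0" by (metis alg_closed_imp_poly_has_root zero_less_Suc)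
  then obtain q where q: "p = [:-a, 1:] * q" by (metis dvdE poly_eq_0_iff_dvd)
  have q0: "q \<noteq> 0" using Suc.prems q by auto
  have "Polynomial.degree p = Polynomial.degree q + 1"
    unfolding q using q0 by (subst degree_mult_eq) auto
  then have deg: "d = Polynomial.degree q" using Suc.hyps by simp
  have pd: "poly (pderiv p) x = poly q x + (x - a) * poly (pderiv q) x" for x
    unfolding q pderiv_mult by (simp add: pderiv_pCons algebra_simps)
  have card: "card {x. poly q x = 0} = Polynomial.degree q"
  proof (rule Suc.hyps(1)[OF deg q0])
    fix x assume "poly q x = 0"
    then have "poly p x = 0" by (simp add: q)
    then show "poly (pderiv q) x \<noteq> 0" using Suc.prems(2)[of x] pd[of x] \<open>poly q x = 0\<close> by auto
  qed
  have "poly q a \<noteq> 0" using Suc.prems(2)[OF a] pd[of a] by simp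
  moreover have "{x. poly p x = 0} = insert a {x. poly q x = 0}" by (auto simp: q)
  ultimately show ?case using card deg Suc.hyps(2) poly_roots_finite[OF q0] by simp
qed

lemma bit_alg_closure_two_eq_zero: "(2 :: bit alg_closure) = 0"
proof -
  have "to_ac (1 + 1 :: bit) = to_ac 1 + to_ac 1" by (rule to_ac_add)
  then show ?thesis by simp
qed

text \<open>In characteristic 2 the cross term of a square vanishes, so squaring is additive, and so
  are its iterates.\<close>

lemma bit_alg_closure_frobenius_add:
  "(x + y :: bit alg_closure) ^ (2 ^ m) = x ^ (2 ^ m) + y ^ (2 ^ m)"
proof (induction m)
  case (Suc m)
  have square: "z ^ (2 ^ Suc m) = (z ^ 2 ^ m)\<^sup>2" for z :: "bit alg_closure"
    by (metis power_Suc2 power_mult)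
  have "(x + y) ^ (2 ^ Suc m) = (x ^ 2 ^ m + y ^ 2 ^ m)\<^sup>2"
    by (simp only: square Suc)
  also have "\<dots> = (x ^ 2 ^ m)\<^sup>2 + (y ^ 2 ^ m)\<^sup>2"
    by (simp add: power2_sum bit_alg_closure_two_eq_zero)
  finally show ?case by (simp only: square)
qed simp

text \<open>The solutions of \<open>x ^ q = x\<close> with \<open>q = 2 ^ m\<close> are closed under
  addition by Frobenius. They are the roots of a polynomial of degree \<open>q\<close> whose
  derivative is the constant -1, so there are exactly \<open>q\<close> of them.\<close>

lemma ex_finite_field_set_of_card_power2:
  assumes "0 < m"
  shows "\<exists>K :: bit alg_closure set. finite_field_set K \<and> card K = 2 ^ m"
proof -
  define q :: nat where "q = 2 ^ m"
  define p :: "bit alg_closure poly" where "p = monom 1 q - monom 1 1"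
  define K where "K = {x :: bit alg_closure. x ^ q = x}"
  have q: "1 < q" unfolding q_def using one_less_power[of "2::nat" m] assms by simp
  have K: "K = {x. poly p x = 0}" by (auto simp: K_def p_def poly_monom)
  have deg: "Polynomial.degree p = q"
    unfolding p_def using q by (intro antisym degree_le le_degree) auto
  then have p0: "p \<noteq> 0" using q by auto
  have "of_nat q = (0 :: bit alg_closure)"
    unfolding q_def using assms by (simp add: bit_alg_closure_two_eq_zero)
  then have "pderiv p = - 1"
    unfolding p_def by (simp add: pderiv_diff pderiv_monom monom_0 one_pCons)
  then have card: "card K = q" unfolding K using card_roots_of_separable[OF p0] deg by simp
  have neg: "- x = x" for x :: "bit alg_closure"
    using bit_alg_closure_two_eq_zero by (metis add_eq_0_iff mult_2 mult_zero_left)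
  have "finite_field_set K"
  proof
    show "finite K" unfolding K using p0 by (rule poly_roots_finite)
    show "x + y \<in> K" if "x \<in> K" "y \<in> K" for x y
      using that bit_alg_closure_frobenius_add[of x y m] by (simp add: K_def q_def)
  qed (use q in \<open>auto simp: K_def power_mult_distrib power_inverse neg\<close>)
  then show ?thesis using card q_def by blast
qed

section \<open>Vandermonde systems and polynomials of bounded degree\<close>

text \<open>Pair the relations with the coefficients of a polynomial \<open>P\<close> that vanishes
  at every node except \<open>\<beta> j\<close>. Its degree \<open>card J - 1\<close> is below
  \<open>a\<close>, so the pairing is zero, yet only the term
  \<open>c j * poly P (\<beta> j)\<close> survives.\<close>

lemma vandermonde_columns_indep:
  fixes \<beta> c :: "'b \<Rightarrow> 'k::field"
  assumes "finite J" "card J \<le> a" "inj_on \<beta> J"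
    and zero: "\<And>i. i < a \<Longrightarrow> (\<Sum>j\<in>J. c j * \<beta> j ^ i) = 0"
    and "j \<in> J"
  shows "c j = 0"
proof -
  define P where "P = (\<Prod>k\<in>J - {j}. [:- \<beta> k, 1:])"
  have deg: "Polynomial.degree P < a"
  proof -
    have "Polynomial.degree P \<le> (\<Sum>k\<in>J - {j}. Polynomial.degree [:- \<beta> k, 1:])"
      unfolding P_def using degree_prod_sum_le[of "J - {j}" "\<lambda>k. [:- \<beta> k, 1:]"] assms(1)
      by (simp add: o_def)
    also have "\<dots> = card J - 1" using assms(1,5) by simp
    also have "\<dots> < a" using assms(1,2,5) by (metis card_gt_0_iff diff_less empty_iff less_le_trans zero_less_one)
    finally show ?thesis .
  qed
  have "(\<Sum>k\<in>J. c k * poly P (\<beta> k)) = (\<Sum>k\<in>J. \<Sum>i\<le>Polynomial.degree P. Polynomial.coeff P i * (c k * \<beta> k ^ i))"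
    by (simp add: poly_altdef sum_distrib_left mult_ac)
  also have "\<dots> = (\<Sum>i\<le>Polynomial.degree P. Polynomial.coeff P i * (\<Sum>k\<in>J. c k * \<beta> k ^ i))"
    by (subst sum.swap) (simp add: sum_distrib_left)
  also have "\<dots> = 0" using deg zero by (intro sum.neutral) auto
  finally have "(\<Sum>k\<in>J. c k * poly P (\<beta> k)) = 0" .
  moreover have "(\<Sum>k\<in>J. c k * poly P (\<beta> k)) = c j * poly P (\<beta> j)"
  proof -
    have "poly P (\<beta> k) = 0" if "k \<in> J - {j}" for k
      unfolding P_def poly_prod using assms(1) that by (intro prod_zero) auto
    then show ?thesis using assms(1,5) by (simp add: sum.remove)
  qed
  moreover have "poly P (\<beta> j) \<noteq> 0"
    unfolding P_def poly_prod using assms(1,3,5) by (auto simp: inj_on_def)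
  ultimately show ?thesis by simp
qed

definition coord_poly :: "nat \<Rightarrow> (nat \<Rightarrow> 'k::field) \<Rightarrow> 'k poly" where
  "coord_poly a c = (\<Sum>i<a. monom (c i) i)"

lemma poly_coord_poly: "poly (coord_poly a c) x = (\<Sum>i<a. c i * x ^ i)"
  by (simp add: coord_poly_def poly_sum poly_monom)

lemma coeff_coord_poly: "Polynomial.coeff (coord_poly a c) i = (if i < a then c i else 0)"
  by (simp add: coord_poly_def coeff_sum)

lemma card_roots_coord_poly:
  assumes "inj_on \<alpha> {..<r::nat}" "coord_poly a c \<noteq> 0"
  shows "card {j. j < r \<and> poly (coord_poly a c) (\<alpha> j) = 0} < a"
proof -
  let ?p = "coord_poly a c"
  have "0 < a" using assms(2) by (auto simp: coord_poly_def intro: ccontr)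
  have "inj_on \<alpha> {j. j < r \<and> poly ?p (\<alpha> j) = 0}"
    using assms(1) by (rule inj_on_subset) auto
  then have "card {j. j < r \<and> poly ?p (\<alpha> j) = 0} = card (\<alpha> ` {j. j < r \<and> poly ?p (\<alpha> j) = 0})"
    by (simp add: card_image)
  also have "\<dots> \<le> card {x. poly ?p x = 0}"
    using assms(2) by (intro card_mono poly_roots_finite) auto
  also have "\<dots> \<le> Polynomial.degree ?p" using assms(2) by (rule card_poly_roots_bound)
  also have "\<dots> \<le> a - 1" by (rule degree_le) (use \<open>0 < a\<close> in \<open>auto simp: coeff_coord_poly\<close>)
  finally show ?thesis using \<open>0 < a\<close> by simp
qed

text \<open>Provides a codeword of minimum weight. The coefficients must lie in \<open>K\<close>
  itself, hence the induction on coefficient sequences.\<close>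

lemma (in finite_field_set) ex_coords_vanishing_on_prefix:
  assumes "\<And>j. j < b \<Longrightarrow> \<alpha> j \<in> K"
  shows "\<exists>c. (\<forall>i. c i \<in> K) \<and> (\<forall>x. (\<Sum>i<Suc b. c i * x ^ i) = (\<Prod>j<b. x - \<alpha> j))"
  using assms
proof (induction b)
  case 0
  show ?case by (rule exI[of _ "\<lambda>_. 1"]) (simp add: one_in)
next
  case (Suc b)
  then obtain c where c: "\<And>i. c i \<in> K" "\<And>x. (\<Sum>i<Suc b. c i * x ^ i) = (\<Prod>j<b. x - \<alpha> j)"
    by (metis less_Suc_eq)
  \<comment> \<open>Multiplication by \<open>x - \<alpha> b\<close>: a shift minus
    \<open>\<alpha> b\<close> times the old sequence, cut off at \<open>Suc b\<close> because
    nothing is known about \<open>c\<close> beyond that.\<close>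
  define c' where "c' i = (if i = 0 then 0 else c (i - 1)) - \<alpha> b * (if i < Suc b then c i else 0)" for i
  have "c' i \<in> K" for i
    unfolding c'_def using c(1) Suc.prems by (auto intro!: diff_in mult_in minus_in)
  moreover have "(\<Sum>i<Suc (Suc b). c' i * x ^ i) = (\<Prod>j<Suc b. x - \<alpha> j)" for x
  proof -
    have "(\<Sum>i<Suc (Suc b). c' i * x ^ i) =
      (\<Sum>i<Suc (Suc b). (if i = 0 then 0 else c (i - 1)) * x ^ i)
      - \<alpha> b * (\<Sum>i<Suc (Suc b). (if i < Suc b then c i else 0) * x ^ i)"
      by (simp add: c'_def algebra_simps sum_subtractf sum_distrib_left del: sum.lessThan_Suc)
    also have "(\<Sum>i<Suc (Suc b). (if i = 0 then 0 else c (i - 1)) * x ^ i) = x * (\<Sum>i<Suc b. c i * x ^ i)"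
      by (subst sum.lessThan_Suc_shift) (simp add: sum_distrib_left mult_ac del: sum.lessThan_Suc)
    also have "(\<Sum>i<Suc (Suc b). (if i < Suc b then c i else 0) * x ^ i) = (\<Sum>i<Suc b. c i * x ^ i)"
      by simp
    finally show ?thesis by (simp add: c(2) algebra_simps del: sum.lessThan_Suc)
  qed
  ultimately show ?case by blast
qed

section \<open>The local parity checks\<close>

text \<open>These are the equations of the block-diagonal rows with one Vandermonde block repeated.
  Each sum runs over a whole group, so a relation among selected columns is to be extended by
  zero.\<close>

definition local_checks :: "(nat \<Rightarrow> 'k::field) \<Rightarrow> nat \<Rightarrow> nat \<Rightarrow> nat \<Rightarrow> (nat \<Rightarrow> 'k) \<Rightarrow> bool" where
  "local_checks \<alpha> g r a c \<longleftrightarrow>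
     (\<forall>p<g. \<forall>i<a. (\<Sum>j | j div r = p. c j * \<alpha> (j mod r) ^ i) = 0)"

lemma group_eq:
  fixes r :: nat
  assumes "0 < r"
  shows "{j. j div r = p} = {p * r..<p * r + r}"
proof (rule Set.set_eqI)
  fix j
  have "p * r \<le> j \<and> j < p * r + r" if "j div r = p"
    using that div_mult_mod_eq[of j r] mod_less_divisor[OF assms, of j] by (metis add_less_cancel_left le_add1)
  moreover have "j div r = p" if "p * r \<le> j" "j < p * r + r"
    using that by (intro div_nat_eqI) (simp_all add: mult.commute)
  ultimately show "j \<in> {j. j div r = p} \<longleftrightarrow> j \<in> {p * r..<p * r + r}"
    unfolding mem_Collect_eq atLeastLessThan_iff by blast
qed

lemma finite_group: "0 < r \<Longrightarrow> finite {j. j div r = p}" for r :: nat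
  by (simp add: group_eq)

text \<open>At most \<open>a\<close> columns of one group have distinct Vandermonde nodes and are
  independent. This serves both to find information coordinates and to discard groups without an
  extra column.\<close>

lemma local_checks_imp_zero:
  fixes \<alpha> c :: "nat \<Rightarrow> 'k::field"
  assumes "0 < r" "inj_on \<alpha> {..<r}" "local_checks \<alpha> g r a c" "p < g"
    and supp: "\<And>j. j div r = p \<Longrightarrow> c j \<noteq> 0 \<Longrightarrow> j \<in> J"
    and card: "card {j \<in> J. j div r = p} \<le> a"
    and "j div r = p"
  shows "c j = 0"
proof (rule ccontr)
  assume nz: "c j \<noteq> 0"
  let ?J = "{j \<in> J. j div r = p}"
  have fin: "finite ?J" using finite_group[OF assms(1), of p] by (rule finite_subset[rotated]) auto
  have zero: "(\<Sum>j\<in>?J. c j * \<alpha> (j mod r) ^ i) = 0" if "i < a" for i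
  proof -
    have "(\<Sum>j\<in>?J. c j * \<alpha> (j mod r) ^ i) = (\<Sum>j | j div r = p. c j * \<alpha> (j mod r) ^ i)"
      using supp finite_group[OF assms(1), of p] by (intro sum.mono_neutral_left) auto
    then show ?thesis using assms(3,4) that by (simp add: local_checks_def)
  qed
  have inj: "inj_on (\<lambda>j. \<alpha> (j mod r)) ?J"
  proof (rule inj_onI)
    fix x y assume "x \<in> ?J" "y \<in> ?J" "\<alpha> (x mod r) = \<alpha> (y mod r)"
    moreover from this have "x mod r = y mod r"
      using assms(1,2) by (simp add: inj_on_eq_iff)
    ultimately show "x = y" by (metis (mono_tags, lifting) div_mult_mod_eq mem_Collect_eq)
  qed
  have "j \<in> ?J" using assms(7) supp nz by auto
  then have "c j = 0" using vandermonde_columns_indep[OF fin card inj, of c j] zero by blast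
  then show False using nz by simp
qed

section \<open>Spaces of local relations and the greedy choice of columns\<close>

context finite_field_set
begin

text \<open>These are the dependences among the columns in \<open>S\<close> that the local rows do
  not detect; the global rows have to exclude the nonzero ones.\<close>

definition check_space where
  "check_space \<alpha> g r a S =
     {c. (\<forall>j. c j \<in> K) \<and> (\<forall>j. j \<notin> S \<longrightarrow> c j = 0) \<and> local_checks \<alpha> g r a c}"

lemma check_space_scale:
  "c \<in> check_space \<alpha> g r a S \<Longrightarrow> k \<in> K \<Longrightarrow> (\<lambda>j. k * c j) \<in> check_space \<alpha> g r a S"
  by (simp add: check_space_def local_checks_def mult_in mult.assoc flip: sum_distrib_left)

text \<open>The coordinates in \<open>U\<close> determine a vector: the difference of two vectors
  agreeing on \<open>U\<close> lives on \<open>S - U\<close>, with at most \<open>a\<close>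
  coordinates per group, and so vanishes. Fixing the coordinate \<open>j\<close> leaves
  \<open>h - 1\<close> free ones.\<close>

lemma card_check_space_slice:
  assumes "0 < r" "inj_on \<alpha> {..<r}" "S \<subseteq> {..<g * r}" "U \<subseteq> S" "j \<in> U" "card U = h"
    and card: "\<And>p. p < g \<Longrightarrow> card {i \<in> S - U. i div r = p} \<le> a"
  shows "finite {c \<in> check_space \<alpha> g r a S. c j = 1} \<and>
    card {c \<in> check_space \<alpha> g r a S. c j = 1} \<le> card K ^ (h - 1)"
proof -
  let ?V = "{c \<in> check_space \<alpha> g r a S. c j = 1}"
  let ?res = "\<lambda>c. restrict c (U - {j})"
  have finU: "finite U" using assms(3,4) by (meson finite_lessThan finite_subset)
  have inj: "inj_on ?res ?V"
  proof (rule inj_onI)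
    fix c d assume c: "c \<in> ?V" and d: "d \<in> ?V" and eq: "?res c = ?res d"
    have U: "c i = d i" if "i \<in> U" for i
      using c d fun_cong[OF eq, of i] that by (cases "i = j") auto
    have chk: "local_checks \<alpha> g r a (\<lambda>i. c i - d i)"
      using c d by (simp add: check_space_def local_checks_def left_diff_distrib sum_subtractf)
    have supp: "k \<in> S - U" if "c k - d k \<noteq> 0" for k
    proof -
      have "c k = 0" "d k = 0" if "k \<notin> S" using c d that by (auto simp: check_space_def)
      then have "k \<in> S" using that by (metis diff_zero)
      then show ?thesis using U[of k] that by auto
    qed
    have "c i - d i = 0" for i
    proof (cases "i \<in> S")
      case True
      then have "i div r < g" using assms(1,3) by (auto simp: less_mult_imp_div_less)
      then show ?thesis
        using supp card
        by (intro local_checks_imp_zero[OF assms(1,2) chk, where J = "S - U" and p = "i div r"]) auto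
    qed (use c d in \<open>auto simp: check_space_def\<close>)
    then show "c = d" by (auto simp: fun_eq_iff)
  qed
  have sub: "?res ` ?V \<subseteq> (U - {j}) \<rightarrow>\<^sub>E K"
    by (rule image_subsetI) (simp only: restrict_PiE_iff, simp add: check_space_def)
  have fin: "finite ((U - {j}) \<rightarrow>\<^sub>E K)" using finU finite_K by (intro finite_PiE) auto
  have "card ((U - {j}) \<rightarrow>\<^sub>E K) = card K ^ (h - 1)"
    using finU assms(5,6) by (simp add: card_PiE)
  then show ?thesis
    using card_inj_on_le[OF inj sub fin] inj_on_finite[OF inj sub fin] by simp
qed

text \<open>The columns of \<open>D\<close> are chosen one at a time: a new column is forbidden only when it
  equals one of the at most \<open>card P * card K ^ (h - 1)\<close> combinations of earlier columns.\<close>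

lemma ex_columns_avoiding:
  fixes V :: "'b \<Rightarrow> (nat \<Rightarrow> 'k) set" and h n :: nat
  assumes "finite P" "card P < card K" "0 < h"
    and slice: "\<And>S j. S \<in> P \<Longrightarrow> finite {c \<in> V S. c j = 1} \<and> card {c \<in> V S. c j = 1} \<le> card K ^ (h - 1)"
    and scale: "\<And>S c k. S \<in> P \<Longrightarrow> c \<in> V S \<Longrightarrow> k \<in> K \<Longrightarrow> (\<lambda>i. k * c i) \<in> V S"
    and coords: "\<And>S c i. S \<in> P \<Longrightarrow> c \<in> V S \<Longrightarrow> c i \<in> K"
  shows "\<exists>D. (\<forall>j t. D j t \<in> K) \<and> (\<forall>S\<in>P. \<forall>c\<in>V S. (\<forall>i\<ge>n. c i = 0) \<longrightarrow>
    (\<forall>t<h. (\<Sum>i<n. c i * D i t) = 0) \<longrightarrow> (\<forall>i. c i = 0))"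
proof (induction n)
  case 0
  show ?case by (rule exI[of _ "\<lambda>_ _. 0"]) (simp add: zero_in)
next
  case (Suc n)
  then obtain D where DK: "\<And>j t. D j t \<in> K"
    and D: "\<And>S c. S \<in> P \<Longrightarrow> c \<in> V S \<Longrightarrow> (\<And>i. i \<ge> n \<Longrightarrow> c i = 0) \<Longrightarrow>
        (\<And>t. t < h \<Longrightarrow> (\<Sum>i<n. c i * D i t) = 0) \<Longrightarrow> \<forall>i. c i = 0"
    by blast
  \<comment> \<open>For a relation with \<open>c n = 1\<close>, column \<open>n\<close> is forced to
    equal \<open>comb c\<close>; the restriction makes columns elements of the product set that is
    counted below.\<close>
  define comb where "comb c = restrict (\<lambda>t. - (\<Sum>i<n. c i * D i t)) {..<h}" for c
  \<comment> \<open>Vectors reaching beyond \<open>n\<close> are included as well; this only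
    enlarges \<open>bad\<close>, and the bound \<open>slice\<close> applies as it stands.\<close>
  define W where "W S = {c \<in> V S. c n = 1}" for S
  define bad where "bad = comb ` (\<Union>S\<in>P. W S)"
  have finW: "finite (\<Union>S\<in>P. W S)" using assms(1) slice by (auto simp: W_def)
  have "card bad \<le> card (\<Union>S\<in>P. W S)" unfolding bad_def by (rule card_image_le[OF finW])
  also have "\<dots> \<le> (\<Sum>S\<in>P. card (W S))" by (rule card_UN_le[OF assms(1)])
  also have "\<dots> \<le> (\<Sum>S\<in>P. card K ^ (h - 1))" using slice by (intro sum_mono) (auto simp: W_def)
  also have "\<dots> = card P * card K ^ (h - 1)" by simp
  also have "\<dots> < card K * card K ^ (h - 1)" using assms(2) card_pos by simp
  also have "\<dots> = card ({..<h} \<rightarrow>\<^sub>E K)" using assms(3) by (simp add: card_PiE power_eq_if)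
  finally have "card bad < card ({..<h} \<rightarrow>\<^sub>E K)" .
  moreover have "finite bad" unfolding bad_def using finW by simp
  ultimately have "\<not> ({..<h} \<rightarrow>\<^sub>E K) \<subseteq> bad" by (meson card_mono leD)
  then obtain d where d: "d \<in> {..<h} \<rightarrow>\<^sub>E K" "d \<notin> bad" by blast
  define D' where "D' = D(n := \<lambda>t. if t < h then d t else 0)"
  have sum_D': "(\<Sum>i<Suc n. c i * D' i t) = (\<Sum>i<n. c i * D i t) + c n * d t" if "t < h" for c t
    using that by (simp add: D'_def)
  have "\<forall>i. c i = 0"
    if S: "S \<in> P" and c: "c \<in> V S" and supp: "\<And>i. i \<ge> Suc n \<Longrightarrow> c i = 0"
      and zero: "\<And>t. t < h \<Longrightarrow> (\<Sum>i<Suc n. c i * D' i t) = 0" for S c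
  proof (cases "c n = 0")
    case True
    show ?thesis
    proof (rule D[OF S c])
      show "c i = 0" if "n \<le> i" for i using that True supp[of i] by (cases "i = n") auto
      show "(\<Sum>i<n. c i * D i t) = 0" if "t < h" for t using zero[OF that] sum_D'[OF that, of c] True by simp
    qed
  next
    case False
    \<comment> \<open>Normalising the last coordinate to 1 exhibits \<open>d\<close> as a forbidden
      column.\<close>
    define c' where "c' = (\<lambda>i. inverse (c n) * c i)"
    have "c' \<in> W S"
      unfolding W_def c'_def using False scale[OF S c] inverse_in coords[OF S c] by simp
    moreover have "d = comb c'"
    proof
      fix t
      show "d t = comb c' t"
      proof (cases "t < h")
        case True
        have "(\<Sum>i<n. c' i * D i t) = inverse (c n) * (\<Sum>i<n. c i * D i t)"
          by (simp add: c'_def sum_distrib_left mult.assoc)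
        also have "(\<Sum>i<n. c i * D i t) = - (c n * d t)"
          using zero[OF True] sum_D'[OF True, of c] by (simp add: eq_neg_iff_add_eq_0)
        finally show ?thesis using True False by (simp add: comb_def)
      next
        case False
        then show ?thesis using d(1) by (auto simp: comb_def PiE_def extensional_def)
      qed
    qed
    ultimately have "d \<in> bad" unfolding bad_def using S by blast
    then show ?thesis using d(2) by simp
  qed
  moreover have "D' j t \<in> K" for j t using DK d(1) zero_in by (auto simp: D'_def)
  ultimately show ?case by (intro exI[of _ D']) blast
qed

end

section \<open>Counting the relevant supports\<close>

definition supports :: "nat \<Rightarrow> nat \<Rightarrow> nat \<Rightarrow> nat set set" where
  "supports g r h = {S. \<exists>G\<subseteq>{..<g}. card G \<le> h \<and> S \<subseteq> {j. j div r \<in> G}}"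

lemma finite_card_groups:
  fixes r :: nat
  assumes "0 < r" "finite G"
  shows "finite {j. j div r \<in> G} \<and> card {j. j div r \<in> G} \<le> r * card G"
proof -
  have eq: "{j. j div r \<in> G} = (\<Union>p\<in>G. {j. j div r = p})" by auto
  have "card (\<Union>p\<in>G. {j. j div r = p}) \<le> (\<Sum>p\<in>G. card {j. j div r = p})"
    by (rule card_UN_le[OF assms(2)])
  also have "\<dots> = r * card G" using assms(1) by (simp add: group_eq)
  finally show ?thesis unfolding eq using assms finite_group by auto
qed

lemma finite_supports:
  assumes "0 < r"
  shows "finite (supports g r h)"
proof (rule finite_subset)
  show "supports g r h \<subseteq> Pow {j. j div r \<in> {..<g}}" by (auto simp: supports_def)
  show "finite (Pow {j. j div r \<in> {..<g}})" using finite_card_groups[OF assms, of "{..<g}"] by simp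
qed

text \<open>Each choice of groups \<open>G\<close> admits at most \<open>2 ^ (r * card G)\<close>
  sets. As \<open>y \<le> 1\<close>, the weight \<open>y ^ h\<close> is at most
  \<open>y ^ card G\<close>; extending the sum to all \<open>G\<close> makes it the expansion of a
  product.\<close>

lemma card_supports:
  assumes "0 < r" "0 < y" "y \<le> 1"
  shows "real (card (supports g r h)) * y ^ h \<le> (1 + 2 ^ r * y) ^ g"
proof -
  let ?Gs = "{G. G \<subseteq> {..<g} \<and> card G \<le> h}"
  have fin: "finite ?Gs" by (rule finite_subset[of _ "Pow {..<g}"]) auto
  have sub: "supports g r h \<subseteq> (\<Union>G\<in>?Gs. Pow {j. j div r \<in> G})" by (auto simp: supports_def)
  have finG: "finite {j. j div r \<in> G} \<and> card {j. j div r \<in> G} \<le> r * card G" if "G \<in> ?Gs" for G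
    using that by (intro finite_card_groups[OF assms(1)]) (auto intro: finite_subset)
  have "card (supports g r h) \<le> card (\<Union>G\<in>?Gs. Pow {j. j div r \<in> G})"
    using fin finG by (intro card_mono[OF _ sub]) auto
  also have "\<dots> \<le> (\<Sum>G\<in>?Gs. card (Pow {j. j div r \<in> G}))" by (rule card_UN_le[OF fin])
  also have "\<dots> \<le> (\<Sum>G\<in>?Gs. 2 ^ (r * card G))"
    using finG by (intro sum_mono) (simp add: card_Pow)
  finally have "real (card (supports g r h)) \<le> real (\<Sum>G\<in>?Gs. 2 ^ (r * card G))"
    by (rule of_nat_mono)
  then have "real (card (supports g r h)) * y ^ h \<le> (\<Sum>G\<in>?Gs. 2 ^ (r * card G) * y ^ h)"
    using assms(2) by (simp add: sum_distrib_right[symmetric])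
  also have "\<dots> \<le> (\<Sum>G\<in>?Gs. (2 ^ r * y) ^ card G)"
    using assms(2,3) by (intro sum_mono) (auto simp: power_mult_distrib power_mult intro!: mult_left_mono power_decreasing)
  also have "\<dots> \<le> (\<Sum>G\<in>Pow {..<g}. (2 ^ r * y) ^ card G)"
    using assms(2) by (intro sum_mono2) auto
  also have "\<dots> = (\<Prod>p<g. 2 ^ r * y + 1)"
    by (subst prod_add) (auto simp: prod_constant)
  also have "\<dots> = (1 + 2 ^ r * y) ^ g" by (simp add: add.commute)
  finally show ?thesis .
qed

section \<open>Global rows that break every local relation\<close>

context finite_field_set
begin

text \<open>A relation on \<open>T \<union> U\<close> lives on the groups met by \<open>U\<close>,
  hence on a set from \<open>supports\<close>. The greedy choice therefore needs only as many field
  elements as there are such sets, plus one.\<close>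

lemma ex_global_rows:
  assumes "0 < r" "0 < h" and inj: "inj_on \<alpha> {..<r}" and card: "card (supports g r h) < card K"
  shows "\<exists>D. (\<forall>j t. D j t \<in> K) \<and>
    (\<forall>T U c. T \<subseteq> {..<g * r} \<longrightarrow> (\<forall>p<g. card {j \<in> T. j div r = p} = a) \<longrightarrow>
      U \<subseteq> {..<g * r} - T \<longrightarrow> card U = h \<longrightarrow>
      (\<forall>j. c j \<in> K) \<longrightarrow> (\<forall>j. j \<notin> T \<union> U \<longrightarrow> c j = 0) \<longrightarrow>
      local_checks \<alpha> g r a c \<longrightarrow> (\<forall>t<h. (\<Sum>j<g * r. c j * D j t) = 0) \<longrightarrow> (\<forall>j. c j = 0))"
proof -
  \<comment> \<open>Every \<open>j \<in> S\<close> can serve as one of the \<open>h\<close> extra columns, which are information coordinates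
    of the check space; fixing \<open>c j = 1\<close> therefore saves a factor \<open>card K\<close>.\<close>
  define exchangeable where "exchangeable S \<longleftrightarrow> S \<subseteq> {..<g * r} \<and>
    (\<forall>j\<in>S. \<exists>U\<subseteq>S. j \<in> U \<and> card U = h \<and> (\<forall>p<g. card {i \<in> S - U. i div r = p} \<le> a))" for S
  define P where "P = {S \<in> supports g r h. exchangeable S}"
  define V where "V = check_space \<alpha> g r a"
  have fin: "finite P" unfolding P_def using finite_supports[OF assms(1)] by simp
  have cardP: "card P < card K"
    using card card_mono[OF finite_supports[OF assms(1)], of P g h] by (auto simp: P_def)
  have slice: "finite {c \<in> V S. c j = 1} \<and> card {c \<in> V S. c j = 1} \<le> card K ^ (h - 1)"
    if "S \<in> P" for S j
  proof (cases "j \<in> S")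
    case True
    have "exchangeable S" using that by (simp add: P_def)
    then obtain U where "S \<subseteq> {..<g * r}" "U \<subseteq> S" "j \<in> U" "card U = h"
      "\<And>p. p < g \<Longrightarrow> card {i \<in> S - U. i div r = p} \<le> a"
      using True unfolding exchangeable_def by blast
    then show ?thesis unfolding V_def by (intro card_check_space_slice[OF assms(1) inj])
  next
    case False
    then have empty: "{c \<in> V S. c j = 1} = {}" by (auto simp: V_def check_space_def)
    show ?thesis unfolding empty by simp
  qed
  have scale: "(\<lambda>i. k * c i) \<in> V S" if "c \<in> V S" "k \<in> K" for S c k
    using that check_space_scale by (simp add: V_def)
  have coords: "c i \<in> K" if "c \<in> V S" for S c i
    using that by (simp add: V_def check_space_def)
  have "\<exists>D. (\<forall>j t. D j t \<in> K) \<and> (\<forall>S\<in>P. \<forall>c\<in>V S. (\<forall>i\<ge>g * r. c i = 0) \<longrightarrow>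
      (\<forall>t<h. (\<Sum>i<g * r. c i * D i t) = 0) \<longrightarrow> (\<forall>i. c i = 0))"
    by (rule ex_columns_avoiding[where V = V]) (use fin cardP assms(2) slice scale coords in blast)+
  then obtain D where DK: "\<forall>j t. D j t \<in> K"
    and D: "\<forall>S\<in>P. \<forall>c\<in>V S. (\<forall>i\<ge>g * r. c i = 0) \<longrightarrow>
      (\<forall>t<h. (\<Sum>i<g * r. c i * D i t) = 0) \<longrightarrow> (\<forall>i. c i = 0)"
    by (elim exE conjE)
  have "\<forall>j. c j = 0"
    if T: "T \<subseteq> {..<g * r}" "\<And>p. p < g \<Longrightarrow> card {j \<in> T. j div r = p} = a"
      and U: "U \<subseteq> {..<g * r} - T" "card U = h"
      and c: "\<And>j. c j \<in> K" "\<And>j. j \<notin> T \<union> U \<Longrightarrow> c j = 0" "local_checks \<alpha> g r a c"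
        "\<And>t. t < h \<Longrightarrow> (\<Sum>j<g * r. c j * D j t) = 0"
    for T U c
  proof -
    have finT: "finite T" and finU: "finite U" using T(1) U(1) by (auto intro: finite_subset)
    have group: "j div r < g" if "j < g * r" for j
      using that by (simp add: less_mult_imp_div_less)
    define G where "G = (\<lambda>j. j div r) ` U"
    \<comment> \<open>Only the groups containing an extra column are kept.\<close>
    define S where "S = {j \<in> T \<union> U. j div r \<in> G}"
    have "U \<subseteq> S" by (auto simp: S_def G_def)
    have "G \<subseteq> {..<g}" using U(1) group by (auto simp: G_def)
    moreover have "card G \<le> h" unfolding G_def using card_image_le[OF finU] U(2) by blast
    ultimately have "S \<in> supports g r h" unfolding supports_def S_def by blast
    moreover have "exchangeable S"
      unfolding exchangeable_def
    proof (intro conjI ballI)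
      show "S \<subseteq> {..<g * r}" using T(1) U(1) by (auto simp: S_def)
      fix j assume j: "j \<in> S"
      show "\<exists>U'\<subseteq>S. j \<in> U' \<and> card U' = h \<and> (\<forall>p<g. card {i \<in> S - U'. i div r = p} \<le> a)"
      proof (cases "j \<in> U")
        case True
        have "card {i \<in> S - U. i div r = p} \<le> a" if "p < g" for p
        proof -
          have "card {i \<in> S - U. i div r = p} \<le> card {i \<in> T. i div r = p}"
            using finT by (intro card_mono) (auto simp: S_def)
          then show ?thesis using T(2)[OF that] by simp
        qed
        then show ?thesis using True \<open>U \<subseteq> S\<close> U(2) by blast
      next
        case False
        with j have jT: "j \<in> T" and "j div r \<in> G" by (auto simp: S_def)
        then obtain u where u: "u \<in> U" "u div r = j div r" by (auto simp: G_def)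
        \<comment> \<open>Exchange \<open>j\<close> with an extra column \<open>u\<close> of the
          same group: the other columns of that group are then among \<open>T\<close> with
          \<open>j\<close> replaced by \<open>u\<close>, still at most \<open>a\<close>.\<close>
        define U' where "U' = insert j (U - {u})"
        have "card U' = Suc (card (U - {u}))"
          unfolding U'_def using False finU by (intro card_insert_disjoint) auto
        then have "card U' = h" using card_Suc_Diff1[OF finU u(1)] U(2) by simp
        moreover have "card {i \<in> S - U'. i div r = p} \<le> a" if "p < g" for p
        proof (cases "p = j div r")
          case True
          let ?Tp = "{i \<in> T. i div r = p}"
          have "card {i \<in> S - U'. i div r = p} \<le> card (insert u (?Tp - {j}))"
            using finT by (intro card_mono) (auto simp: S_def U'_def)
          also have "\<dots> \<le> Suc (card (?Tp - {j}))" by (rule card_insert_le_m1) simp_all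
          also have "\<dots> = card ?Tp" using finT jT True by (intro card_Suc_Diff1) auto
          finally show ?thesis using T(2)[OF that] by simp
        next
          case False
          have "card {i \<in> S - U'. i div r = p} \<le> card {i \<in> T. i div r = p}"
            using finT False u(2) by (intro card_mono) (auto simp: S_def U'_def)
          then show ?thesis using T(2)[OF that] by simp
        qed
        moreover have "U' \<subseteq> S" using \<open>U \<subseteq> S\<close> j by (auto simp: U'_def)
        ultimately show ?thesis by (intro exI[of _ U']) (simp add: U'_def)
      qed
    qed
    moreover have "c \<in> V S"
    proof -
      \<comment> \<open>In a group that \<open>U\<close> misses, \<open>c\<close> is supported on
        the \<open>a\<close> columns from \<open>T\<close>, so the local checks make it vanish
        there.\<close>
      have "c j = 0" if "j \<notin> S" for j
      proof (cases "j \<in> T \<union> U")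
        case True
        with that have jT: "j \<in> T" and jG: "j div r \<notin> G" by (auto simp: S_def G_def)
        have "j div r < g" using T(1) jT group by blast
        moreover have "k \<in> T" if "k div r = j div r" "c k \<noteq> 0" for k
          using c(2)[of k] that jG by (auto simp: G_def) (metis image_eqI)
        ultimately show ?thesis
          using T(2) by (intro local_checks_imp_zero[OF assms(1) inj c(3), where J = T]) auto
      qed (use c(2) in blast)
      then show ?thesis using c by (simp add: V_def check_space_def)
    qed
    moreover have "c i = 0" if "i \<ge> g * r" for i
    proof -
      have "i \<notin> T \<union> U" using that T(1) U(1) by force
      then show ?thesis by (rule c(2))
    qed
    ultimately show ?thesis using D c(4) unfolding P_def mem_Collect_eq by blast
  qed
  then show ?thesis using DK by (intro exI[of _ D]) blast
qed

end

section \<open>Transport to a ring record on the natural numbers\<close>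

text \<open>The notion \<open>MR_LRC\<close> asks for a ring record over \<open>nat\<close>;
  \<open>\<psi>\<close> carries its arithmetic to \<open>K\<close>, where the linear algebra above
  is available.\<close>

locale nat_copy = finite_field_set K for K :: "'k::field set" +
  fixes F :: "nat ring" and \<psi> :: "nat \<Rightarrow> 'k"
  assumes field_F: "field F"
    and bij: "bij_betw \<psi> (carrier F) K"
    and psi_zero: "\<psi> \<zero>\<^bsub>F\<^esub> = 0"
    and psi_add: "x \<in> carrier F \<Longrightarrow> y \<in> carrier F \<Longrightarrow> \<psi> (x \<oplus>\<^bsub>F\<^esub> y) = \<psi> x + \<psi> y"
    and psi_mult: "x \<in> carrier F \<Longrightarrow> y \<in> carrier F \<Longrightarrow> \<psi> (x \<otimes>\<^bsub>F\<^esub> y) = \<psi> x * \<psi> y"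

text \<open>Transport of structure along an arbitrary enumeration of \<open>K\<close>. Having an
  initial segment as carrier later makes \<open>\<psi>\<close> itself a list of distinct evaluation
  points.\<close>

lemma (in finite_field_set) ex_nat_copy:
  "\<exists>F \<psi>. nat_copy K F \<psi> \<and> carrier F = {..<card K}"
proof -
  let ?C = "{..<card K}"
  obtain \<psi> where bij: "bij_betw \<psi> ?C K"
    using ex_bij_betw_nat_finite[OF finite_K] by (auto simp: atLeast0LessThan)
  define \<phi> where "\<phi> = inv_into ?C \<psi>"
  have \<phi>: "\<phi> x < card K" "\<psi> (\<phi> x) = x" if "x \<in> K" for x
    using bij_betw_inv_into[OF bij] bij_betw_inv_into_right[OF bij] that
    by (auto simp: \<phi>_def bij_betw_def)
  have \<psi>: "\<psi> i \<in> K" "\<phi> (\<psi> i) = i" if "i < card K" for i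
    using bij bij_betw_inv_into_left[OF bij] that by (auto simp: \<phi>_def bij_betw_def)
  define F :: "nat ring" where "F = \<lparr>carrier = ?C, monoid.mult = (\<lambda>x y. \<phi> (\<psi> x * \<psi> y)),
    one = \<phi> 1, zero = \<phi> 0, add = (\<lambda>x y. \<phi> (\<psi> x + \<psi> y))\<rparr>"
  note closed = zero_in one_in add_in mult_in minus_in
  have "cring F"
  proof (rule cringI)
    show "abelian_group F"
    proof (rule abelian_groupI)
      show "\<exists>y\<in>carrier F. y \<oplus>\<^bsub>F\<^esub> x = \<zero>\<^bsub>F\<^esub>" if "x \<in> carrier F" for x
        using that \<phi> \<psi> closed by (intro bexI[of _ "\<phi> (- \<psi> x)"]) (auto simp: F_def)
    qed (use \<phi> \<psi> closed in \<open>auto simp: F_def add_ac\<close>)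
    show "Group.comm_monoid F"
      by (rule comm_monoidI) (use \<phi> \<psi> closed in \<open>auto simp: F_def mult_ac\<close>)
  qed (use \<phi> \<psi> closed in \<open>auto simp: F_def ring_distribs\<close>)
  then have "field F"
  proof (rule cring.cring_fieldI2)
    show "\<zero>\<^bsub>F\<^esub> \<noteq> \<one>\<^bsub>F\<^esub>"
      using \<phi>(2)[OF zero_in] \<phi>(2)[OF one_in] by (auto simp: F_def)
    fix x assume x: "x \<in> carrier F" "x \<noteq> \<zero>\<^bsub>F\<^esub>"
    have "\<psi> x \<noteq> 0" using x \<psi>[of x] by (auto simp: F_def)
    then show "\<exists>y\<in>carrier F. x \<otimes>\<^bsub>F\<^esub> y = \<one>\<^bsub>F\<^esub>"
      using x \<phi> \<psi> inverse_in by (intro bexI[of _ "\<phi> (inverse (\<psi> x))"]) (auto simp: F_def)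
  qed
  then have "nat_copy K F \<psi>"
    by (intro nat_copy.intro finite_field_set_axioms nat_copy_axioms.intro)
       (use bij \<phi> \<psi> closed in \<open>auto simp: F_def\<close>)
  then show ?thesis by (intro exI[of _ F] exI[of _ \<psi>]) (simp add: F_def)
qed

context nat_copy
begin

interpretation F: field F by (rule field_F)

lemma psi_in: "x \<in> carrier F \<Longrightarrow> \<psi> x \<in> K"
  using bij by (auto simp: bij_betw_def)

lemma psi_eq_zero_iff: "x \<in> carrier F \<Longrightarrow> \<psi> x = 0 \<longleftrightarrow> x = \<zero>\<^bsub>F\<^esub>"
  using bij psi_zero F.zero_closed by (metis bij_betw_def inj_on_eq_iff)

lemma psi_finsum:
  "f \<in> S \<rightarrow> carrier F \<Longrightarrow> \<psi> (\<Oplus>\<^bsub>F\<^esub>j\<in>S. f j) = (\<Sum>j\<in>S. \<psi> (f j))"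
proof (induction S rule: infinite_finite_induct)
  \<comment> \<open>For infinite \<open>S\<close> both sums are zero by convention; this case is
    closed at the end together with the empty one.\<close>
  case (insert x S)
  then have f: "f x \<in> carrier F" "f \<in> S \<rightarrow> carrier F" by auto
  with insert show ?case by (simp add: psi_add F.finsum_closed)
qed (simp_all add: psi_zero)

definition \<phi> :: "'k \<Rightarrow> nat" where "\<phi> = inv_into (carrier F) \<psi>"

lemma phi_in: "x \<in> K \<Longrightarrow> \<phi> x \<in> carrier F"
  and psi_phi: "x \<in> K \<Longrightarrow> \<psi> (\<phi> x) = x"
  using bij_betw_inv_into[OF bij] bij_betw_inv_into_right[OF bij]
  by (auto simp: \<phi>_def bij_betw_def)

text \<open>All matrix entries will have the form \<open>\<phi> (v i)\<close>, so this turns each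
  row equation over \<open>F\<close> into a sum in \<open>K\<close>.\<close>

lemma psi_linear_combination:
  assumes "c \<in> I \<rightarrow> carrier F" "\<And>i. i \<in> I \<Longrightarrow> v i \<in> K"
  shows "(\<Oplus>\<^bsub>F\<^esub>i\<in>I. c i \<otimes>\<^bsub>F\<^esub> \<phi> (v i)) \<in> carrier F"
    and "\<psi> (\<Oplus>\<^bsub>F\<^esub>i\<in>I. c i \<otimes>\<^bsub>F\<^esub> \<phi> (v i)) = (\<Sum>i\<in>I. \<psi> (c i) * v i)"
proof -
  have f: "(\<lambda>i. c i \<otimes>\<^bsub>F\<^esub> \<phi> (v i)) \<in> I \<rightarrow> carrier F"
    using assms phi_in by (auto simp: Pi_iff)
  show "(\<Oplus>\<^bsub>F\<^esub>i\<in>I. c i \<otimes>\<^bsub>F\<^esub> \<phi> (v i)) \<in> carrier F" using f by (rule F.finsum_closed)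
  have "\<psi> (c i \<otimes>\<^bsub>F\<^esub> \<phi> (v i)) = \<psi> (c i) * v i" if "i \<in> I" for i
    using assms that phi_in psi_phi by (auto simp: psi_mult Pi_iff)
  then show "\<psi> (\<Oplus>\<^bsub>F\<^esub>i\<in>I. c i \<otimes>\<^bsub>F\<^esub> \<phi> (v i)) = (\<Sum>i\<in>I. \<psi> (c i) * v i)"
    by (simp add: psi_finsum[OF f])
qed

text \<open>This is a Reed-Solomon code: words are values of polynomials of degree below
  \<open>a\<close>, which have at most \<open>a - 1\<close> roots unless they are zero. The product
  over the first \<open>a - 1\<close> nodes attains the bound.\<close>

lemma vandermonde_generates_mds:
  assumes "0 < a" "a \<le> r" and inj: "inj_on \<alpha> {..<r}" and \<alpha>: "\<And>j. j < r \<Longrightarrow> \<alpha> j \<in> K"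
  shows "generates_code F (\<lambda>i j. \<phi> (\<alpha> j ^ i)) r a (r - a + 1)"
proof -
  let ?word = "\<lambda>c j. \<Oplus>\<^bsub>F\<^esub>i\<in>{0..<a}. c i \<otimes>\<^bsub>F\<^esub> \<phi> (\<alpha> j ^ i)"
  let ?p = "\<lambda>c. coord_poly a (\<lambda>i. \<psi> (c i))"
  have word_in: "?word c j \<in> carrier F"
    and word: "?word c j = \<zero>\<^bsub>F\<^esub> \<longleftrightarrow> poly (?p c) (\<alpha> j) = 0"
    if "c \<in> {0..<a} \<rightarrow> carrier F" "j < r" for c j
  proof -
    note * = psi_linear_combination[OF that(1), of "\<lambda>i. \<alpha> j ^ i", OF power_in[OF \<alpha>[OF that(2)]]]
    show "?word c j \<in> carrier F" by (rule *(1))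
    then show "?word c j = \<zero>\<^bsub>F\<^esub> \<longleftrightarrow> poly (?p c) (\<alpha> j) = 0"
      using psi_eq_zero_iff[of "?word c j"] *(2) by (simp add: poly_coord_poly atLeast0LessThan)
  qed
  have weight: "hweight F r (\<lambda>j. if j < r then ?word c j else \<zero>\<^bsub>F\<^esub>)
      = r - card {j. j < r \<and> poly (?p c) (\<alpha> j) = 0}" if "c \<in> {0..<a} \<rightarrow> carrier F" for c
  proof -
    have "hweight F r (\<lambda>j. if j < r then ?word c j else \<zero>\<^bsub>F\<^esub>)
        = card ({..<r} - {j. j < r \<and> poly (?p c) (\<alpha> j) = 0})"
      unfolding hweight_def using word[OF that] by (intro arg_cong[of _ _ card]) auto
    also have "\<dots> = r - card {j. j < r \<and> poly (?p c) (\<alpha> j) = 0}"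
      by (subst card_Diff_subset) auto
    finally show ?thesis .
  qed
  show ?thesis
    unfolding generates_code_def
  proof (intro conjI allI impI ballI)
    show "\<phi> (\<alpha> j ^ i) \<in> carrier F" if "j < r" for i j
      using that \<alpha> by (intro phi_in power_in)
  next
    fix c i assume c: "c \<in> {0..<a} \<rightarrow> carrier F" and zero: "\<forall>j<r. ?word c j = \<zero>\<^bsub>F\<^esub>" and i: "i < a"
    have "?p c = 0"
    proof (rule ccontr)
      assume "?p c \<noteq> 0"
      from card_roots_coord_poly[OF inj this] have "card {j. j < r \<and> poly (?p c) (\<alpha> j) = 0} < a" .
      \<comment> \<open>A zero word would mean \<open>r \<ge> a\<close> roots.\<close>
      moreover have "{j. j < r \<and> poly (?p c) (\<alpha> j) = 0} = {..<r}" using word[OF c] zero by auto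
      ultimately show False using assms(2) by simp
    qed
    then have "\<psi> (c i) = 0" using i coeff_coord_poly[of a "\<lambda>i. \<psi> (c i)" i] by simp
    moreover have "c i \<in> carrier F" using c i by auto
    ultimately show "c i = \<zero>\<^bsub>F\<^esub>" by (simp add: psi_eq_zero_iff)
  next
    fix x assume "x \<in> gen_code F a r (\<lambda>i j. \<phi> (\<alpha> j ^ i))" and nz: "\<exists>j<r. x j \<noteq> \<zero>\<^bsub>F\<^esub>"
    then obtain c where c: "c \<in> {0..<a} \<rightarrow> carrier F"
      and x: "x = (\<lambda>j. if j < r then ?word c j else \<zero>\<^bsub>F\<^esub>)" unfolding gen_code_def by blast
    have "?p c \<noteq> 0" using nz word[OF c] by (auto simp: x)
    from card_roots_coord_poly[OF inj this] show "r - a + 1 \<le> hweight F r x"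
      unfolding x weight[OF c] using assms(2) by simp
  next
    have "\<alpha> j \<in> K" if "j < a - 1" for j using that assms(2) by (intro \<alpha>) simp
    then obtain d where d: "\<And>i. d i \<in> K"
      "\<And>x. (\<Sum>i<Suc (a - 1). d i * x ^ i) = (\<Prod>j<a - 1. x - \<alpha> j)"
      using ex_coords_vanishing_on_prefix[of "a - 1" \<alpha>] by blast
    define c where "c = (\<lambda>i. \<phi> (d i))"
    have c: "c \<in> {0..<a} \<rightarrow> carrier F" using d(1) phi_in by (auto simp: c_def)
    have p: "poly (?p c) x = (\<Prod>j<a - 1. x - \<alpha> j)" for x
      using d assms(1) psi_phi by (simp add: poly_coord_poly c_def)
    have "poly (?p c) (\<alpha> j) = 0 \<longleftrightarrow> j < a - 1" if "j < r" for j
    proof -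
      have "\<alpha> j = \<alpha> k \<longleftrightarrow> j = k" if "k < a - 1" for k
        using inj \<open>j < r\<close> that assms(2) by (intro inj_on_eq_iff[OF inj]) auto
      then show ?thesis by (auto simp: p)
    qed
    then have roots: "{j. j < r \<and> poly (?p c) (\<alpha> j) = 0} = {..<a - 1}" using assms(1,2) by auto
    let ?x = "\<lambda>j. if j < r then ?word c j else \<zero>\<^bsub>F\<^esub>"
    have wt: "hweight F r ?x = r - a + 1" unfolding weight[OF c] roots using assms(1,2) by simp
    have "\<exists>j<r. ?x j \<noteq> \<zero>\<^bsub>F\<^esub>"
    proof (rule ccontr)
      assume "\<not> (\<exists>j<r. ?x j \<noteq> \<zero>\<^bsub>F\<^esub>)"
      then have "{j. j < r \<and> ?x j \<noteq> \<zero>\<^bsub>F\<^esub>} = {}" by blast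
      then have "hweight F r ?x = 0" unfolding hweight_def by (metis card.empty)
      then show False using wt by simp
    qed
    moreover have "?x \<in> gen_code F a r (\<lambda>i j. \<phi> (\<alpha> j ^ i))" unfolding gen_code_def using c by blast
    ultimately show "\<exists>x\<in>gen_code F a r (\<lambda>i j. \<phi> (\<alpha> j ^ i)).
        (\<exists>j<r. x j \<noteq> \<zero>\<^bsub>F\<^esub>) \<and> hweight F r x = r - a + 1"
      using wt by (intro bexI[of _ ?x] conjI)
  qed
qed

end

lemma (in nat_copy) phi_zero: "\<phi> 0 = \<zero>\<^bsub>F\<^esub>"
  using psi_eq_zero_iff[OF phi_in[OF zero_in]] psi_phi[OF zero_in] by simp

text \<open>Read through \<open>\<psi>\<close> and extended by zero, a relation among the columns
  satisfies the local checks and the global equations, so it is trivial by the choice of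
  \<open>D\<close>.\<close>

lemma (in nat_copy) MR_LRC_exists:
  assumes "0 < a" "a \<le> r" "0 < h" "g * a + h < g * r"
    and inj: "inj_on \<alpha> {..<r}" and \<alpha>: "\<And>j. j < r \<Longrightarrow> \<alpha> j \<in> K"
    and card: "card (supports g r h) < card K"
  shows "MR_LRC F (g * r) r h a"
proof -
  have r: "0 < r" and g: "0 < g" using assms(4) by (auto intro: Nat.gr0I)
  obtain D where DK: "\<And>j t. D j t \<in> K"
    and D: "\<forall>T U c. T \<subseteq> {..<g * r} \<longrightarrow> (\<forall>p<g. card {j \<in> T. j div r = p} = a) \<longrightarrow>
      U \<subseteq> {..<g * r} - T \<longrightarrow> card U = h \<longrightarrow>
      (\<forall>j. c j \<in> K) \<longrightarrow> (\<forall>j. j \<notin> T \<union> U \<longrightarrow> c j = 0) \<longrightarrow>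
      local_checks \<alpha> g r a c \<longrightarrow> (\<forall>t<h. (\<Sum>j<g * r. c j * D j t) = 0) \<longrightarrow> (\<forall>j. c j = 0)"
    using ex_global_rows[OF r assms(3) inj card, of a] by (elim exE conjE) blast
  define A where "A = (\<lambda>(p::nat) i j. \<phi> (\<alpha> j ^ i))"
  define D' where "D' = (\<lambda>t j. \<phi> (D j t))"
  have "cols_indep F (g * a + h) (pc_matrix F g r a A D') (T \<union> U)"
    if T: "T \<subseteq> {0..<g * r}" "\<forall>p<g. card {j \<in> T. j div r = p} = a"
      and U: "U \<subseteq> {0..<g * r} - T" "card U = h" for T U
    unfolding cols_indep_def
  proof (intro ballI impI)
    fix c k
    assume c: "c \<in> T \<union> U \<rightarrow> carrier F"
      and rows: "\<forall>i<g * a + h. (\<Oplus>\<^bsub>F\<^esub>j\<in>T \<union> U. c j \<otimes>\<^bsub>F\<^esub> pc_matrix F g r a A D' i j) = \<zero>\<^bsub>F\<^esub>"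
      and k: "k \<in> T \<union> U"
    have fin: "finite (T \<union> U)" and sub: "T \<union> U \<subseteq> {..<g * r}"
      using T(1) U(1) by (auto intro: finite_subset)
    define c' where "c' j = (if j \<in> T \<union> U then \<psi> (c j) else 0)" for j
    have row: "(\<Sum>j\<in>T \<union> U. \<psi> (c j) * v j) = 0"
      if "i < g * a + h" "\<And>j. pc_matrix F g r a A D' i j = \<phi> (v j)" "\<And>j. v j \<in> K" for i v
    proof -
      have "(\<Oplus>\<^bsub>F\<^esub>j\<in>T \<union> U. c j \<otimes>\<^bsub>F\<^esub> \<phi> (v j)) = \<zero>\<^bsub>F\<^esub>"
        using rows that(1) unfolding that(2)[symmetric] by blast
      then show ?thesis
        using psi_linear_combination(2)[OF c, of v] that(3) psi_zero by simp
    qed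
    have "local_checks \<alpha> g r a c'"
      unfolding local_checks_def
    proof (intro allI impI)
      fix p i assume p: "p < g" and i: "i < a"
      \<comment> \<open>The preimage in \<open>K\<close> of row \<open>p * a + i\<close>: because
        \<open>i < a\<close>, this index has quotient \<open>p\<close> and remainder
        \<open>i\<close>, and off the block the entry is \<open>\<phi> 0\<close>.\<close>
      define v where "v j = (if j div r = p then \<alpha> (j mod r) ^ i else 0)" for j
      have "p * a + i < Suc p * a" using i by simp
      also have "\<dots> \<le> g * a" using p by (intro mult_le_mono1) simp
      finally have lt: "p * a + i < g * a" .
      have "(\<Sum>j | j div r = p. c' j * \<alpha> (j mod r) ^ i) = (\<Sum>j\<in>{j \<in> T \<union> U. j div r = p}. c' j * \<alpha> (j mod r) ^ i)"
        using finite_group[OF r, of p] by (intro sum.mono_neutral_right) (auto simp: c'_def)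
      also have "\<dots> = (\<Sum>j\<in>T \<union> U. \<psi> (c j) * v j)"
        using fin by (intro sum.mono_neutral_cong_left) (auto simp: c'_def v_def)
      also have "\<dots> = 0"
      proof (rule row)
        show "pc_matrix F g r a A D' (p * a + i) j = \<phi> (v j)" for j
          using lt i by (auto simp: pc_matrix_def A_def v_def phi_zero)
        show "v j \<in> K" for j using r \<alpha> by (auto simp: v_def zero_in intro: power_in)
      qed (use lt in simp)
      finally show "(\<Sum>j | j div r = p. c' j * \<alpha> (j mod r) ^ i) = 0" .
    qed
    moreover have "(\<Sum>j<g * r. c' j * D j t) = 0" if "t < h" for t
    proof -
      have "(\<Sum>j<g * r. c' j * D j t) = (\<Sum>j\<in>T \<union> U. \<psi> (c j) * D j t)"
        using sub by (intro sum.mono_neutral_cong_right) (auto simp: c'_def)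
      also have "\<dots> = 0"
        by (rule row[of "g * a + t"]) (use that DK in \<open>auto simp: pc_matrix_def D'_def\<close>)
      finally show ?thesis .
    qed
    moreover have "c' j \<in> K" for j using c psi_in zero_in by (auto simp: c'_def Pi_iff)
    moreover have "c' j = 0" if "j \<notin> T \<union> U" for j using that by (simp add: c'_def)
    ultimately have "\<forall>j. c' j = 0"
      using D T U unfolding atLeast0LessThan by blast
    then have "\<psi> (c k) = 0" using k by (metis c'_def)
    moreover have "c k \<in> carrier F" using c k by blast
    ultimately show "c k = \<zero>\<^bsub>F\<^esub>" by (simp add: psi_eq_zero_iff)
  qed
  moreover have "generates_code F (A p) r a (r - a + 1)" for p
    unfolding A_def by (rule vandermonde_generates_mds[OF assms(1,2) inj \<alpha>])
  moreover have "D' t j \<in> carrier F" for t j using DK phi_in by (simp add: D'_def)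
  ultimately show ?thesis
    unfolding MR_LRC_def Let_def using assms(1,3,4) r g
    by (simp only: nonzero_mult_div_cancel_right neq0_conv[symmetric]) (auto intro!: exI[of _ A] exI[of _ D'])
qed

section \<open>Numerical estimates and the choice of the field size\<close>

lemma cube_powr:
  fixes b :: real
  assumes "0 < b"
  shows "(b ^ 3) powr (real k / 3) = b ^ k"
proof -
  have "(b ^ 3) powr (real k / 3) = (b powr real 3) powr (real k / 3)"
    by (simp only: powr_realpow[OF assms])
  also have "\<dots> = b powr real k" unfolding powr_powr by simp
  finally show ?thesis by (simp only: powr_realpow[OF assms])
qed

text \<open>The factor 2 pays for rounding the field size down to a power of two.\<close>

lemma card_supports_less:
  assumes r: "0 < r" and h: "0 < h" and n: "n = g * r"
    and large: "(8 * 2 ^ r) ^ 3 \<le> real n" and hr: "real n powr (2/3) \<le> real h * real r"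
  shows "2 * real (card (supports g r h)) < real n powr (2 * real h / 3)"
proof -
  define z where "z = real n powr (1/3)"
  define N where "N = real (card (supports g r h))"
  have n0: "0 < real n" using large by (rule less_le_trans[rotated]) simp
  have "((8 * 2 ^ r) ^ 3) powr (1/3) \<le> z"
    unfolding z_def using large by (intro powr_mono2) auto
  moreover have "((8 * 2 ^ r) ^ 3) powr (1/3) = (8 * 2 ^ r :: real)"
    using cube_powr[of "8 * 2 ^ r" 1] by simp
  ultimately have z: "8 * 2 ^ r \<le> z" by simp
  have z0: "0 < z" using z by (rule less_le_trans[rotated]) simp
  have zpow: "z ^ k = real n powr (real k / 3)" for k
    using n0 powr_realpow[of z k] by (simp add: z_def powr_powr)
  \<comment> \<open>Chosen so that \<open>2 ^ r * y = 1 / z\<close>. Then the product is at most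
    \<open>exp (g / z)\<close>, and \<open>g / z \<le> h\<close> because
    \<open>g * r = z ^ 3\<close> and \<open>z ^ 2 \<le> h * r\<close>.\<close>
  define y where "y = 1 / (2 ^ r * z)"
  have "1 \<le> z" using z one_le_power[of "2::real" r] by linarith
  then have "1 \<le> 2 ^ r * z" using mult_mono[of 1 "2 ^ r" 1 z] one_le_power[of "2::real" r] by simp
  then have y: "0 < y" "y \<le> 1" using z0 by (auto simp: y_def)
  have "N * y ^ h \<le> (1 + 2 ^ r * y) ^ g" unfolding N_def by (rule card_supports[OF r y])
  also have "\<dots> = (1 + 1 / z) ^ g" by (simp add: y_def)
  also have "\<dots> \<le> exp (1 / z) ^ g" using z0 by (intro power_mono exp_ge_add_one_self) simp
  also have "\<dots> = exp (real g / z)" by (simp add: exp_of_nat_mult[symmetric])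
  also have "\<dots> \<le> exp (real h)"
  proof -
    have "real g * real r = z ^ 2 * z" using n n0 zpow[of 3] by (simp add: power3_eq_cube power2_eq_square)
    moreover have "z ^ 2 \<le> real h * real r" using hr zpow[of 2] by simp
    ultimately have "real g * real r \<le> real h * real r * z" using z0 by simp
    then have "real g \<le> real h * z" using r by (simp add: mult.assoc mult.commute[of "real r"])
    then show ?thesis using z0 by (simp add: divide_le_eq)
  qed
  finally have "N * y ^ h \<le> exp (real h)" .
  then have "N \<le> exp (real h) * (2 ^ r * z) ^ h"
    using z0 by (simp add: y_def power_divide divide_le_eq)
  also have "\<dots> = (exp 1 * (2 ^ r * z)) ^ h"
    using exp_of_nat_mult[of h "1::real"] by (simp add: power_mult_distrib)
  also have "\<dots> \<le> (3 * (2 ^ r * z)) ^ h"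
    using z0 exp_le by (intro power_mono mult_right_mono) auto
  finally have "2 * N \<le> 2 * (3 * (2 ^ r * z)) ^ h" by simp
  also have "\<dots> \<le> 2 ^ h * (3 * (2 ^ r * z)) ^ h"
    using z0 h self_le_power[of "2::real" h] by (intro mult_right_mono) auto
  also have "\<dots> = (2 * (3 * (2 ^ r * z))) ^ h" by (simp only: power_mult_distrib)
  also have "\<dots> = (6 * 2 ^ r * z) ^ h" by (simp only: mult.assoc[symmetric]) simp
  \<comment> \<open>The constant 6 collects the factor 2 and the bound 3 for \<open>exp 1\<close>;
    the size condition on \<open>n\<close> gives \<open>8 * 2 ^ r \<le> z\<close>, which leaves room
    for strictness.\<close>
  also have "\<dots> < (z * z) ^ h"
  proof (rule power_strict_mono)
    have "6 * 2 ^ r < z" using z by (rule less_le_trans[rotated]) simp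
    then show "6 * 2 ^ r * z < z * z" using z0 by simp
  qed (use z0 h in auto)
  also have "\<dots> = real n powr (2 * real h / 3)"
    using zpow[of "2 * h"] by (simp add: power_mult power2_eq_square)
  finally show ?thesis by (simp add: N_def)
qed

text \<open>Take the predecessor of the least exponent whose power exceeds \<open>Z\<close>; it
  exists because \<open>1 \<le> Z\<close>.\<close>

lemma ex_power2_near:
  assumes "1 \<le> (Z :: real)"
  shows "\<exists>m. 2 ^ m \<le> Z \<and> Z < 2 * 2 ^ m"
proof -
  have "Z < 2 ^ m" if "m = nat \<lceil>Z\<rceil>" for m
    using that of_nat_less_two_power[of m, where 'a = real] real_nat_ceiling_ge[of Z] by linarith
  then have "\<exists>m. Z < 2 ^ m" by blast
  then obtain m where m: "Z < 2 ^ m" "\<And>k. k < m \<Longrightarrow> \<not> Z < 2 ^ k" 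
    unfolding exists_least_iff[of "\<lambda>m. Z < 2 ^ m"] by blast
  then have "m \<noteq> 0" using assms by (intro notI) simp
  then obtain k where "m = Suc k" using not0_implies_Suc by blast
  then show ?thesis using m(1) m(2)[of k] by (intro exI[of _ k]) auto
qed

text \<open>The field has \<open>2 ^ m\<close> elements for the largest
  \<open>2 ^ m \<le> Z\<close>. Two things must fit below this size: the \<open>r\<close> evaluation
  points and the number of supports.\<close>

lemma ex_MR_LRC_field:
  assumes a: "0 < a" "a \<le> r" and h: "0 < h" and n: "n = g * r"
    and large: "(8 * 2 ^ r) ^ 3 \<le> real n" and hr: "real n powr (2/3) \<le> real h * real r"
    and dim: "g * a + h < n"
  shows "\<exists>F :: nat ring. field F \<and> finite (carrier F) \<and>
    real (card (carrier F)) \<le> real n powr (2 * real h / 3) \<and> MR_LRC F n r h a"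
proof -
  define Z where "Z = real n powr (2 * real h / 3)"
  have r: "0 < r" using a by simp
  have "((8 * 2 ^ r) ^ 3) powr (2/3) = (8 * 2 ^ r :: real) ^ 2"
    using cube_powr[of "8 * 2 ^ r" 2] by simp
  moreover have "((8 * 2 ^ r) ^ 3) powr (2/3) \<le> real n powr (2/3)"
    using large by (intro powr_mono2) auto
  \<comment> \<open>Here \<open>h \<ge> 1\<close> makes the exponent of \<open>Z\<close> at least
    2/3.\<close>
  moreover have "real n powr (2/3) \<le> Z"
    unfolding Z_def using dim h by (intro powr_mono) auto
  ultimately have "(8 * 2 ^ r) ^ 2 \<le> Z" by simp
  moreover have "2 * 2 ^ r \<le> (8 * 2 ^ r :: real) ^ 2"
  proof -
    have "(2::real) ^ r \<le> (2 ^ r) ^ 2" by (intro self_le_power one_le_power) auto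
    moreover have "(8 * 2 ^ r :: real) ^ 2 = 64 * (2 ^ r) ^ 2" by (simp add: power_mult_distrib)
    moreover have "(0::real) < 2 ^ r" by simp
    ultimately show ?thesis by linarith
  qed
  ultimately have Zr: "2 * 2 ^ r \<le> Z" by linarith
  have "1 \<le> Z" using Zr one_le_power[of "2::real" r] by linarith
  then obtain m where m: "2 ^ m \<le> Z" "Z < 2 * 2 ^ m" using ex_power2_near by blast
  have "(2::real) ^ r < 2 ^ m" using Zr m(2) by linarith
  then have "r < m" by simp
  then obtain K :: "bit alg_closure set" where "finite_field_set K" and cardK: "card K = 2 ^ m"
    using ex_finite_field_set_of_card_power2[of m] by auto
  interpret finite_field_set K by fact
  obtain F \<psi> where "nat_copy K F \<psi>" and carrier: "carrier F = {..<card K}"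
    using ex_nat_copy by blast
  interpret nat_copy K F \<psi> by fact
  have "r < card K" unfolding cardK using \<open>r < m\<close> less_exp[of m] by linarith
  \<comment> \<open>The evaluation points are the first \<open>r\<close> elements in the enumeration
    of \<open>K\<close>.\<close>
  have inj: "inj_on \<psi> {..<r}"
    using bij \<open>r < card K\<close> unfolding bij_betw_def carrier by (auto intro: inj_on_subset)
  have "real (card (supports g r h)) < 2 ^ m"
    using card_supports_less[OF r h n large hr] m(2) unfolding Z_def by linarith
  then have "card (supports g r h) < card K" 
    unfolding cardK using of_nat_less_iff[of "card (supports g r h)" "2 ^ m", where 'a = real] by simp
  then have "MR_LRC F n r h a"
    unfolding n using a h dim n \<open>r < card K\<close> psi_in carrier
    by (intro MR_LRC_exists[OF _ _ _ _ inj]) auto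
  then show ?thesis using field_F carrier cardK m(1) by (intro exI[of _ F]) (simp add: Z_def)
qed

section \<open>Infinitely many admissible lengths\<close>

theorem theorem4p3:
  shows "\<exists>c1 c2 :: real. 0 < c1 \<and> 0 < c2 \<and>
    (\<forall>a r :: nat. 0 < a \<longrightarrow> a \<le> r \<longrightarrow>
      infinite {n :: nat. r dvd n \<and> real r powr (c1 * real r) \<le> real n \<and>
        (\<forall>(\<epsilon>::real) (h::nat). 0 < \<epsilon> \<longrightarrow> \<epsilon> < 1/2 \<longrightarrow> 0 < h \<longrightarrow>
           c2 * real n powr (2/3) / \<epsilon> \<le> real h * real r \<longrightarrow>
           (n div r) * a + h < n \<longrightarrow>
           (\<exists>F :: nat ring. field F \<and> finite (carrier F) \<and>
              real (card (carrier F)) \<le> real n powr (2 * real h / 3 * (1 + \<epsilon>)) \<and>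
              MR_LRC F n r h a))})"
\<comment> \<open>Both constants are 1.\<close>
proof (intro exI[of _ 1] conjI allI impI)
  fix a r :: nat assume a: "0 < a" "a \<le> r"
  let ?good = "\<lambda>n. r dvd n \<and> real r powr (1 * real r) \<le> real n \<and>
        (\<forall>(\<epsilon>::real) (h::nat). 0 < \<epsilon> \<longrightarrow> \<epsilon> < 1/2 \<longrightarrow> 0 < h \<longrightarrow>
           1 * real n powr (2/3) / \<epsilon> \<le> real h * real r \<longrightarrow>
           (n div r) * a + h < n \<longrightarrow>
           (\<exists>F :: nat ring. field F \<and> finite (carrier F) \<and>
              real (card (carrier F)) \<le> real n powr (2 * real h / 3 * (1 + \<epsilon>)) \<and>
              MR_LRC F n r h a))"
  \<comment> \<open>The first summand secures \<open>n \<ge> r ^ r\<close>, the second the size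
    condition of the estimates; every multiple \<open>(B + k) * r\<close> then qualifies.\<close>
  define B where "B = r ^ r + (8 * 2 ^ r) ^ 3"
  have good: "?good ((B + k) * r)" for k
  proof -
    define n where "n = (B + k) * r"
    have "1 \<le> r" using a by simp
    then have "(B + k) * 1 \<le> n" unfolding n_def by (rule mult_le_mono2)
    then have "B \<le> n" by (metis add_leD1 mult_1_right)
    then have le: "r ^ r \<le> n" "(8 * 2 ^ r) ^ 3 \<le> n" unfolding B_def by linarith+
    have pw: "real r ^ r \<le> real n" using of_nat_mono[OF le(1), where 'a = real] by simp
    have large: "(8 * 2 ^ r) ^ 3 \<le> real n" using of_nat_mono[OF le(2), where 'a = real] by simp
    have "0 < r ^ r" using a by simp
    then have n0: "1 \<le> n" using le(1) by linarith
    have div: "n div r = B + k" unfolding n_def using a by simp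
    have "\<exists>F :: nat ring. field F \<and> finite (carrier F) \<and>
              real (card (carrier F)) \<le> real n powr (2 * real h / 3 * (1 + \<epsilon>)) \<and> MR_LRC F n r h a"
      if "0 < \<epsilon>" "\<epsilon> < 1/2" "0 < h" "1 * real n powr (2/3) / \<epsilon> \<le> real h * real r"
        "(n div r) * a + h < n" for \<epsilon> :: real and h
    proof -
      \<comment> \<open>As \<open>\<epsilon> < 1\<close>, dividing by it only increases the left
        side, so the hypothesis yields \<open>n powr (2/3) \<le> h * r\<close>.\<close>
      have "real n powr (2/3) \<le> real n powr (2/3) / \<epsilon>"
        using that(1,2) by (simp add: le_divide_eq mult_left_le)
      then have hr: "real n powr (2/3) \<le> real h * real r" using that(4) by simp
      have "real n powr (2 * real h / 3) \<le> real n powr (2 * real h / 3 * (1 + \<epsilon>))"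
        using n0 that(1) by (intro powr_mono) (auto simp: field_simps)
      then show ?thesis
        using ex_MR_LRC_field[OF a that(3) n_def large hr] that(5) unfolding div by (meson order_trans)
    qed
    then show ?thesis
      unfolding n_def[symmetric] using pw a by (auto simp: powr_realpow n_def)
  qed
  have "inj (\<lambda>k. (B + k) * r)" using a by (auto simp: inj_on_def)
  then have "infinite (range (\<lambda>k. (B + k) * r))" by (rule range_inj_infinite)
  moreover have "range (\<lambda>k. (B + k) * r) \<subseteq> {n. ?good n}" using good by blast
  ultimately show "infinite {n. ?good n}" by (rule infinite_super[rotated])
qed simp_all

end
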